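(* Let $i,j\in\mathbb{N}_0=\{0,1,2,\dots\}$, and let $\alpha,\beta,x\in\mathbb{C}$. Each of the following three formulas holds for all such $\alpha,\beta$ for which every expression occurring in that formula is well defined (i.e. no denominator parameter of any hypergeometric series occurring in it is a non-positive integer, and no Pochhammer symbol occurring in a denominator vanishes). (1) $$ {}_1F_1\!\left[\begin{array}{c}\alpha\\ 2\alpha+i\end{array};x\right]\cdot{}_1F_1\!\left[\begin{array}{c}\beta\\ 2\beta+j\end{array};x\right] = e^x\sum_{m=0}^i\sum_{n=0}^j\frac{(-i)_m(-j)_n(2\alpha-1)_m(2\beta-1)_n\,x^{m+n}}{(2\alpha+i)_m(2\beta+j)_n\left(\alpha-\frac12\right)_m\left(\beta-\frac12\right)_n2^{2m+2n}\,m!\,n!} $$ $$ \times\;{}_2F_3\!\left[\begin{array}{c}\frac12(\alpha+\beta+m+n+1),\ \frac12(\alpha+\beta+m+n)\\ \alpha+m+\frac12,\ \beta+n+\frac12,\ \alpha+\beta+m+n\end{array};\frac{x^2}{4}\right]. $$ (2) $$ {}_1F_1\!\left[\begin{array}{c}\alpha\\ 2\alpha-i\end{array};x\right]\cdot{}_1F_1\!\left[\begin{array}{c}\beta\\ 2\beta-j\end{array};x\right] = e^x\sum_{m=0}^i\sum_{n=0}^j\frac{(-1)^{m+n}(-i)_m(-j)_n(2\alpha-2i-1)_m(2\beta-2j-1)_n\,x^{m+n}}{(2\alpha-i)_m(2\beta-j)_n\left(\alpha-i-\frac12\right)_m\left(\beta-j-\frac12\right)_n2^{2m+2n}\,m!\,n!}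 $$ $$ \times\;{}_2F_3\!\left[\begin{array}{c}\frac12(\alpha+\beta+m+n-i-j+1),\ \frac12(\alpha+\beta+m+n-i-j)\\ \alpha+m-i+\frac12,\ \beta+n-j+\frac12,\ \alpha+\beta+m+n-i-j\end{array};\frac{x^2}{4}\right]. $$ (3) $$ {}_1F_1\!\left[\begin{array}{c}\alpha\\ 2\alpha+i\end{array};x\right]\cdot{}_1F_1\!\left[\begin{array}{c}\beta\\ 2\beta-j\end{array};x\right] = e^x\sum_{m=0}^i\sum_{n=0}^j\frac{(-1)^{n}(-i)_m(-j)_n(2\alpha-1)_m(2\beta-2j-1)_n\,x^{m+n}}{(2\alpha+i)_m(2\beta-j)_n\left(\alpha-\frac12\right)_m\left(\beta-j-\frac12\right)_n2^{2m+2n}\,m!\,n!} $$ $$ \times\;{}_2F_3\!\left[\begin{array}{c}\frac12(\alpha+\beta+m+n-j+1),\ \frac12(\alpha+\beta+m+n-j)\\ \alpha+m+\frac12,\ \beta+n-j+\frac12,\ \alpha+\beta+m+n-j\end{array};\frac{x^2}{4}\right]. $$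
   Context: For $a\in\mathbb{C}$ and $k\in\mathbb{N}_0$, the Pochhammer symbol is $(a)_0=1$ and $(a)_k=a(a+1)\cdots(a+k-1)$ for $k\ge1$. For non-negative integers $p\le q$, complex numbers $a_1,\dots,a_p$, and complex numbers $b_1,\dots,b_q$ none of which is a non-positive integer, the generalized hypergeometric series is $$ {}_pF_q\!\left[\begin{array}{c}a_1,\dots,a_p\\ b_1,\dots,b_q\end{array};z\right]=\sum_{k=0}^\infty\frac{(a_1)_k\cdots(a_p)_k}{(b_1)_k\cdots(b_q)_k}\,\frac{z^k}{k!}, $$ which converges for every $z\in\mathbb{C}$. The $b$'s are called the denominator parameters. *)

theory Defs
  imports "HOL-Analysis.Analysis"
begin

(* This is the generalized hypergeometric function when length as <= length bs (so that the series
   converges for every z) and no element of bs is a non-positive integer. *)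
definition hypergeom :: "complex list \<Rightarrow> complex list \<Rightarrow> complex \<Rightarrow> complex" where
  "hypergeom as bs z =
     (\<Sum>k. prod_list (map (\<lambda>a. pochhammer a k) as) / prod_list (map (\<lambda>b. pochhammer b k) bs)
            * (z ^ k / fact k))"

definition denom_params_ok :: "complex list \<Rightarrow> bool" where
  "denom_params_ok bs \<longleftrightarrow> set bs \<inter> \<int>\<^sub>\<le>\<^sub>0 = {}"

end

theory Submission
  imports Defs
begin

text \<open>
  Everything rests on Kummer's second transformation, which removes the factor \<open>exp (x/2)\<close> from
  \<open>1F1[a; 2a; x]\<close> and leaves an even function:
  \<open>1F1[a; 2a; x] = exp (x/2) * 0F1[; a + 1/2; x^2/16]\<close>.  If the denominator parameter is moved
  away from \<open>2a\<close> by an integer \<open>i\<close>, the single \<open>0F1\<close> becomes a combination of \<open>i + 1\<close> of them,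
  with parameters \<open>a + m + 1/2\<close>.  Multiplying two such expansions produces \<open>exp x\<close> and a double sum
  of products of two \<open>0F1\<close> at the same argument.  By the Chu--Vandermonde identity each product is
  a single \<open>2F3\<close>, at four times the argument, that is at \<open>x^2/4\<close>.  This is the theorem; the
  multiplication is carried out in \<open>kummer_product\<close>.

  The expansion for \<open>2a + i\<close> (\<open>kummer_second_generalised\<close>) is obtained by induction on \<open>i\<close>.  The
  contiguous relation
  \<open>1F1[a; b+1; x] = 1F1[a; b; x] - a/(b(b+1)) x 1F1[a+1; b+2; x]\<close> with \<open>b = 2a + i\<close> expresses the
  case \<open>(a, i+1)\<close> through \<open>(a, i)\<close> and \<open>(a+1, i)\<close>, and the coefficients of the expansion satisfy the
  same recurrence (\<open>kummer_coeff_Suc\<close>).  The base case \<open>i = 0\<close> follows from the differential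
  equation.

  The induction meets an obstacle: for \<open>a\<close> a non-positive integer the case \<open>i + 1\<close> can be well defined
  while an intermediate case is not (\<open>a = 0\<close>, \<open>i = 1\<close> is the simplest example).  It is therefore
  carried out only for \<open>2a\<close> not an integer.  For fixed \<open>i\<close>, each Taylor coefficient of either side is
  a rational function of \<open>a\<close> that is continuous wherever the identity is meaningful, so the
  remaining values of \<open>a\<close> are reached as limits.

  The expansion for \<open>2a - i\<close> is the one for \<open>2c + i\<close> with \<open>c = a - i\<close>, read at \<open>-x\<close>: Kummer's first
  transformation \<open>1F1[a; b; x] = exp x * 1F1[b-a; b; -x]\<close> exchanges the two.

  Identities are proved for formal power series and then evaluated, all series involved being
  entire.
\<close>

unbundle no vec_syntax
unbundle fps_syntax

section \<open>Hypergeometric series as entire power series\<close>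

definition hypergeom_fps :: "complex list \<Rightarrow> complex list \<Rightarrow> complex fps" where
  "hypergeom_fps as bs = Abs_fps (\<lambda>k. prod_list (map (\<lambda>a. pochhammer a k) as) /
     prod_list (map (\<lambda>b. pochhammer b k) bs) / fact k)"

lemma eval_hypergeom_fps: "eval_fps (hypergeom_fps as bs) z = hypergeom as bs z"
  by (simp add: eval_fps_def hypergeom_def hypergeom_fps_def)

lemma hypergeom_fps_nth_Suc:
  "hypergeom_fps as bs $ Suc k = hypergeom_fps as bs $ k *
     (prod_list (map (\<lambda>a. a + of_nat k) as) / prod_list (map (\<lambda>b. b + of_nat k) bs) / of_nat (Suc k))"
proof -
  have "prod_list (map (\<lambda>a. pochhammer a (Suc k)) xs) =
      prod_list (map (\<lambda>a. pochhammer a k) xs) * prod_list (map (\<lambda>a. a + of_nat k) xs)" for xs :: "complex list"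
    by (induction xs) (simp_all add: pochhammer_Suc)
  then show ?thesis
    by (simp add: hypergeom_fps_def)
qed

lemma filterlim_add_of_nat_at_infinity:
  "filterlim (\<lambda>k. b + of_nat k :: complex) at_infinity sequentially"
  by (intro tendsto_add_filterlim_at_infinity[OF tendsto_const] tendsto_of_nat)

text \<open>
  Pairing each numerator parameter with a denominator parameter, the quotients
  \<open>(a + k) / (b + k)\<close> tend to 1; unpaired denominator parameters and the factor \<open>k + 1\<close> coming
  from the factorial contribute factors tending to 0.
\<close>

lemma hypergeom_ratio_tendsto_0:
  fixes as bs :: "complex list"
  assumes "length as \<le> length bs"
  shows "(\<lambda>k. prod_list (map (\<lambda>a. a + of_nat k) as) / prod_list (map (\<lambda>b. b + of_nat k) bs)
            / of_nat (Suc k)) \<longlonglongrightarrow> 0"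
  using assms
proof (induction bs arbitrary: as)
  case Nil
  then show ?case
    using LIMSEQ_Suc[OF lim_inverse_n[where 'a = complex]] by (simp add: divide_inverse del: of_nat_Suc)
next
  case (Cons b bs)
  show ?case
  proof (cases as)
    case Nil
    have "(\<lambda>k. 1 / (b + of_nat k)) \<longlonglongrightarrow> 0"
      by (intro tendsto_divide_0[OF tendsto_const] filterlim_add_of_nat_at_infinity)
    from tendsto_mult[OF this Cons.IH[of "[]"]] show ?thesis
      using Nil by (simp add: mult_ac)
  next
    case as: (Cons a as')
    have ne: "\<forall>\<^sub>F k in sequentially. b + of_nat k \<noteq> 0"
      by (intro filterlim_at_infinity_imp_eventually_ne filterlim_add_of_nat_at_infinity)
    have "(\<lambda>k. 1 + (a - b) / (b + of_nat k)) \<longlonglongrightarrow> 1 + 0"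
      by (intro tendsto_add tendsto_const tendsto_divide_0[OF tendsto_const]
          filterlim_add_of_nat_at_infinity)
    moreover have "\<forall>\<^sub>F k in sequentially.
        1 + (a - b) / (b + of_nat k) = (a + of_nat k) / (b + of_nat k)"
      using ne by eventually_elim (simp add: field_simps)
    ultimately have "(\<lambda>k. (a + of_nat k) / (b + of_nat k)) \<longlonglongrightarrow> 1"
      by (simp add: tendsto_cong)
    from tendsto_mult[OF this Cons.IH[of as']] Cons.prems show ?thesis
      by (simp add: as mult_ac)
  qed
qed

text \<open>
  The ratio test in the form \<open>f (k+1) \<le> c * f k\<close> also covers series that terminate.
\<close>

lemma fps_conv_radius_hypergeom_fps:
  assumes "length as \<le> length bs"
  shows "fps_conv_radius (hypergeom_fps as bs) = \<infinity>"
  unfolding fps_conv_radius_def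
proof (rule conv_radius_inftyI'')
  fix z :: complex
  define r where "r k = prod_list (map (\<lambda>a. a + of_nat k) as) /
    prod_list (map (\<lambda>b. b + of_nat k) bs) / of_nat (Suc k)" for k
  have "(\<lambda>k. norm (r k * z)) \<longlonglongrightarrow> 0"
    using tendsto_norm[OF tendsto_mult_right[OF hypergeom_ratio_tendsto_0[OF assms], of z]]
    by (simp add: r_def)
  then have "\<forall>\<^sub>F k in sequentially. norm (r k * z) < 1/2"
    by (rule order_tendstoD) simp
  then obtain N where N: "\<And>k. k \<ge> N \<Longrightarrow> norm (r k * z) < 1/2"
    by (auto simp: eventually_sequentially)
  show "summable (\<lambda>k. hypergeom_fps as bs $ k * z ^ k)"
  proof (rule summable_ratio_test[of "1/2" N])
    fix k assume "N \<le> k"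
    have "norm (hypergeom_fps as bs $ Suc k * z ^ Suc k) =
        norm (r k * z) * norm (hypergeom_fps as bs $ k * z ^ k)"
      by (simp add: hypergeom_fps_nth_Suc r_def norm_mult norm_divide)
    also have "\<dots> \<le> 1/2 * norm (hypergeom_fps as bs $ k * z ^ k)"
      using N[OF \<open>N \<le> k\<close>] by (intro mult_right_mono) auto
    finally show "norm (hypergeom_fps as bs $ Suc k * z ^ Suc k)
        \<le> 1/2 * norm (hypergeom_fps as bs $ k * z ^ k)" .
  qed simp
qed

section \<open>Consequences of the Chu--Vandermonde identity\<close>

text \<open>
  The sums below contain quotients \<open>(a)_n / (a)_k\<close>, whereas \<open>pochhammer_binomial_sum\<close>
  needs \<open>(c)_(n-k)\<close> with \<open>c\<close> independent of \<open>k\<close>.  The next two lemmas convert one into the other,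
  with \<open>c = 1 - a - n\<close>.
\<close>

lemma pochhammer_reflect:
  fixes a :: complex
  assumes "k \<le> n"
  shows "pochhammer (a + of_nat k) (n - k) = (-1) ^ (n - k) * pochhammer (1 - a - of_nat n) (n - k)"
  using pochhammer_minus'[of "a + of_nat n - 1" "n - k"] assms
  by (simp add: of_nat_diff algebra_simps)

lemma pochhammer_divide:
  fixes a :: complex
  assumes "a \<notin> \<int>\<^sub>\<le>\<^sub>0" "k \<le> n"
  shows "pochhammer a n / pochhammer a k = pochhammer (a + of_nat k) (n - k)"
  using pochhammer_product[OF assms(2), of a] pochhammer_eq_0_imp_nonpos_Int[of a k] assms(1)
  by (auto simp: field_simps)

text \<open>
  The Cauchy product of the two series is a Vandermonde sum with value
  \<open>(a+b-1+n)_n = (a+b-1)_(2n) / (a+b-1)_n\<close>; the duplication formula for \<open>(a+b-1)_(2n)\<close> supplies the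
  two halved numerator parameters and the factor \<open>4^n\<close>, which quadruples the argument.
\<close>

lemma hypergeom_0F1_mult_fps:
  assumes "denom_params_ok [a, b, a + b - 1]"
  shows "hypergeom_fps [] [a] * hypergeom_fps [] [b] =
    Abs_fps (\<lambda>n. 4 ^ n * hypergeom_fps [(a + b) / 2, (a + b - 1) / 2] [a, b, a + b - 1] $ n)"
proof (rule fps_ext)
  fix n
  have a: "a \<notin> \<int>\<^sub>\<le>\<^sub>0" and b: "b \<notin> \<int>\<^sub>\<le>\<^sub>0" and c: "a + b - 1 \<notin> \<int>\<^sub>\<le>\<^sub>0"
    using assms by (auto simp: denom_params_ok_def)
  note nz = pochhammer_eq_0_imp_nonpos_Int
  have nz_a: "pochhammer a k \<noteq> 0" and nz_b: "pochhammer b k \<noteq> 0"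
    and nz_c: "pochhammer (a + b - 1) k \<noteq> 0" for k
    using nz[of a k] nz[of b k] nz[of "a + b - 1" k] a b c by auto
  have "pochhammer (a + b - 1 + of_nat n) n =
      (-1) ^ n * pochhammer ((1 - b - of_nat n) + (1 - a - of_nat n)) n"
    using pochhammer_minus'[of "a + b - 2 + 2 * of_nat n" n] by (simp add: algebra_simps)
  also have "\<dots> = (\<Sum>k\<le>n. of_nat (n choose k) * (pochhammer b n / pochhammer b (n - k)) *
      (pochhammer a n / pochhammer a k))"
    unfolding pochhammer_binomial_sum sum_distrib_left
  proof (rule sum.cong, goal_cases)
    case (2 k)
    then have k: "k \<le> n" by simp
    have "(-1) ^ n = ((-1) ^ k * (-1) ^ (n - k) :: complex)"
      using k by (simp flip: power_add)
    then show ?case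
      using k pochhammer_reflect[of "n - k" n b] pochhammer_reflect[OF k, of a]
      by (simp add: pochhammer_divide a b)
  qed simp
  finally have vandermonde: "pochhammer (a + b - 1 + of_nat n) n = \<dots>" .

  have "(hypergeom_fps [] [a] * hypergeom_fps [] [b]) $ n =
     (\<Sum>k\<le>n. 1 / (pochhammer a k * fact k) * (1 / (pochhammer b (n - k) * fact (n - k))))"
    by (simp add: fps_mult_nth hypergeom_fps_def atLeast0AtMost)
  also have "\<dots> = (\<Sum>k\<le>n. of_nat (n choose k) * (pochhammer b n / pochhammer b (n - k)) *
      (pochhammer a n / pochhammer a k)) / (pochhammer a n * pochhammer b n * fact n)"
    unfolding sum_divide_distrib
    by (intro sum.cong) (auto simp: binomial_fact nz_a nz_b divide_simps)
  also have "\<dots> = pochhammer (a + b - 1 + of_nat n) n / (pochhammer a n * pochhammer b n * fact n)"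
    by (simp add: vandermonde)
  also have "\<dots> = pochhammer (a + b - 1) (2 * n) /
      (pochhammer a n * pochhammer b n * pochhammer (a + b - 1) n * fact n)"
    using pochhammer_product'[of "a + b - 1" n n] by (simp add: nz_c mult_2)
  also have "pochhammer (a + b - 1) (2 * n) =
      4 ^ n * pochhammer ((a + b - 1) / 2) n * pochhammer ((a + b) / 2) n"
    using pochhammer_double[of "(a + b - 1) / 2" n]
    by (simp add: power_mult diff_divide_distrib add_divide_distrib)
  finally show "(hypergeom_fps [] [a] * hypergeom_fps [] [b]) $ n =
      Abs_fps (\<lambda>n. 4 ^ n * hypergeom_fps [(a + b) / 2, (a + b - 1) / 2] [a, b, a + b - 1] $ n) $ n"
    by (simp add: hypergeom_fps_def mult_ac)
qed

lemma hypergeom_0F1_mult: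
  assumes "denom_params_ok [a, b, a + b - 1]"
  shows "hypergeom [] [a] z * hypergeom [] [b] z =
     hypergeom [(a + b) / 2, (a + b - 1) / 2] [a, b, a + b - 1] (4 * z)"
proof -
  have "hypergeom [] [a] z * hypergeom [] [b] z = eval_fps (hypergeom_fps [] [a] * hypergeom_fps [] [b]) z"
    by (subst eval_fps_mult) (simp_all add: fps_conv_radius_hypergeom_fps eval_hypergeom_fps)
  also have "\<dots> = hypergeom [(a + b) / 2, (a + b - 1) / 2] [a, b, a + b - 1] (4 * z)"
    by (simp add: hypergeom_0F1_mult_fps[OF assms] eval_fps_def power_mult_distrib mult_ac
       flip: eval_hypergeom_fps)
  finally show ?thesis .
qed

text \<open>
  The coefficients of \<open>exp x * 1F1[b-a; b; -x]\<close> are Vandermonde sums with parameters \<open>b - a\<close> and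
  \<open>1 - b - n\<close>; these add up to \<open>1 - a - n\<close>, and \<open>(1 - a - n)_n = (-1)^n (a)_n\<close>.
\<close>

lemma kummer_first_transformation:
  assumes "b \<notin> \<int>\<^sub>\<le>\<^sub>0"
  shows "hypergeom [a] [b] x = exp x * hypergeom [b - a] [b] (-x)"
proof -
  define R where "R = Abs_fps (\<lambda>k. (-1) ^ k * hypergeom_fps [b - a] [b] $ k)"
  have nz: "pochhammer b k \<noteq> 0" for k
    using pochhammer_eq_0_imp_nonpos_Int[of b k] assms by auto
  have eval_R: "eval_fps R y = hypergeom [b - a] [b] (-y)" for y
    by (simp add: R_def eval_fps_def power_minus[of y] mult_ac flip: eval_hypergeom_fps)
  have "norm (fps_nth R k) = norm (fps_nth (hypergeom_fps [b - a] [b]) k)" for k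
    by (simp add: R_def norm_mult norm_power)
  then have "fps_conv_radius R = fps_conv_radius (hypergeom_fps [b - a] [b])"
    by (subst (1 2) fps_conv_radius_norm [symmetric]) simp
  then have R_entire: "fps_conv_radius R = \<infinity>"
    by (simp add: fps_conv_radius_hypergeom_fps)
  have "hypergeom_fps [a] [b] = R * fps_exp 1"
  proof (rule fps_ext)
    fix n
    have "pochhammer a n = (-1) ^ n * pochhammer ((b - a) + (1 - b - of_nat n)) n"
      using pochhammer_minus'[of "a + of_nat n - 1" n] by (simp add: algebra_simps)
    also have "\<dots> = (\<Sum>k\<le>n. of_nat (n choose k) * ((-1) ^ k * pochhammer (b - a) k) *
        (pochhammer b n / pochhammer b k))"
      unfolding pochhammer_binomial_sum sum_distrib_left
    proof (rule sum.cong, goal_cases)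
      case (2 k)
      then have k: "k \<le> n" by simp
      have "(-1) ^ n = ((-1) ^ k * (-1) ^ (n - k) :: complex)"
        using k by (simp flip: power_add)
      then show ?case
        using k pochhammer_reflect[OF k, of b]
        by (simp add: pochhammer_divide assms)
    qed simp
    finally have "hypergeom_fps [a] [b] $ n = (\<Sum>k\<le>n. of_nat (n choose k) *
        ((-1) ^ k * pochhammer (b - a) k) * (pochhammer b n / pochhammer b k)) / pochhammer b n / fact n"
      by (simp add: hypergeom_fps_def)
    also have "\<dots> = (R * fps_exp 1) $ n"
      unfolding sum_divide_distrib fps_mult_nth atLeast0AtMost
      by (intro sum.cong) (auto simp: R_def hypergeom_fps_def binomial_fact nz divide_simps)
    finally show "hypergeom_fps [a] [b] $ n = (R * fps_exp 1) $ n" .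
  qed
  then have "hypergeom [a] [b] x = eval_fps (R * fps_exp 1) x"
    by (simp flip: eval_hypergeom_fps)
  also have "\<dots> = exp x * hypergeom [b - a] [b] (-x)"
    by (subst eval_fps_mult) (simp_all add: R_entire eval_R)
  finally show ?thesis .
qed

section \<open>Kummer's second transformation\<close>

text \<open>
  The expansion of \<open>0F1[; b; x^2/16]\<close> in powers of \<open>x\<close>.  Up to the factor
  \<open>Gamma b * (x/4) powr (1 - b)\<close> this is the modified Bessel function \<open>I\<close> of order \<open>b - 1\<close> at \<open>x/2\<close>.
\<close>

definition bessel_fps :: "complex \<Rightarrow> complex fps" where
  "bessel_fps b = Abs_fps (\<lambda>n. if even n then hypergeom_fps [] [b] $ (n div 2) / 16 ^ (n div 2) else 0)"

lemma bessel_fps_sums: "(\<lambda>n. bessel_fps b $ n * x ^ n) sums hypergeom [] [b] (x\<^sup>2 / 16)"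
proof -
  have "(\<lambda>k. hypergeom_fps [] [b] $ k * (x\<^sup>2 / 16) ^ k) sums hypergeom [] [b] (x\<^sup>2 / 16)"
    using sums_eval_fps[of "x\<^sup>2 / 16" "hypergeom_fps [] [b]"]
    by (simp add: fps_conv_radius_hypergeom_fps eval_hypergeom_fps)
  also have "(\<lambda>k. hypergeom_fps [] [b] $ k * (x\<^sup>2 / 16) ^ k) =
      (\<lambda>k. bessel_fps b $ (2 * k) * x ^ (2 * k))"
    by (simp add: bessel_fps_def power_divide flip: power_mult)
  finally show ?thesis
    by (subst (asm) sums_mono_reindex)
       (auto simp: strict_mono_def bessel_fps_def elim!: evenE)
qed

lemma eval_bessel_fps: "eval_fps (bessel_fps b) x = hypergeom [] [b] (x\<^sup>2 / 16)"
  using bessel_fps_sums[of b x] by (simp add: eval_fps_def sums_iff)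

lemma fps_conv_radius_bessel_fps: "fps_conv_radius (bessel_fps b) = \<infinity>"
  unfolding fps_conv_radius_def
  by (rule conv_radius_inftyI'') (use bessel_fps_sums sums_summable in blast)

lemma kummer_ode_fps:
  assumes "b \<notin> \<int>\<^sub>\<le>\<^sub>0"
  shows "fps_X * fps_deriv (fps_deriv (hypergeom_fps [a] [b])) +
    (fps_const b - fps_X) * fps_deriv (hypergeom_fps [a] [b]) - fps_const a * hypergeom_fps [a] [b] = 0"
proof (rule fps_ext)
  fix n
  let ?M = "hypergeom_fps [a] [b]"
  have "b + of_nat n \<noteq> 0"
    using assms plus_of_nat_eq_0_imp by blast
  then have "?M $ Suc n * ((b + of_nat n) * of_nat (Suc n)) = ?M $ n * (a + of_nat n)"
    by (simp add: hypergeom_fps_nth_Suc del: of_nat_Suc)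
  then show "(fps_X * fps_deriv (fps_deriv ?M) + (fps_const b - fps_X) * fps_deriv ?M -
      fps_const a * ?M) $ n = 0 $ n"
    by (cases n) (simp_all add: algebra_simps)
qed

text \<open>
  For \<open>b = 2a\<close> the substitution \<open>M = exp (x/2) Y\<close> removes the terms of Kummer's equation that mix
  parities: it becomes \<open>x Y'' + 2a Y' = x Y / 4\<close>.  Hence \<open>Y\<close> is even, and its even coefficients obey
  the two-term recurrence of the Bessel series.
\<close>

lemma kummer_second_fps:
  assumes "2 * a \<notin> \<int>\<^sub>\<le>\<^sub>0"
  shows "fps_exp (-1/2) * hypergeom_fps [a] [2 * a] = bessel_fps (a + 1/2)"
proof (rule fps_ext)
  define M where "M = hypergeom_fps [a] [2 * a]"
  define E :: "complex fps" where "E = fps_exp (-1/2)"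
  define Y where "Y = E * M"
  \<comment> \<open>Naming the series 1/2 turns the change of variable into ring algebra modulo \<open>h + h = 1\<close>.\<close>
  define h :: "complex fps" where "h = fps_const (1/2)"
  have h: "h + h = 1" and h2: "h * h = fps_const (1/4)"
    by (simp_all add: h_def)
  have dE: "fps_deriv E = - h * E" and dh: "fps_deriv h = 0"
    by (simp_all add: E_def h_def flip: fps_const_neg)
  have dM: "E * fps_deriv M = fps_deriv Y + h * Y"
    by (simp add: Y_def dE algebra_simps)
  have "E * fps_deriv (fps_deriv M) = fps_deriv (E * fps_deriv M) + h * (E * fps_deriv M)"
    by (simp add: dE algebra_simps)
  also have "\<dots> = fps_deriv (fps_deriv Y) + (h + h) * fps_deriv Y + h * h * Y"
    unfolding dM by (simp add: dh algebra_simps)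
  finally have ddM: "E * fps_deriv (fps_deriv M) =
      fps_deriv (fps_deriv Y) + fps_deriv Y + h * h * Y"
    by (simp add: h)
  have "E * (fps_X * fps_deriv (fps_deriv M) + (fps_const (2 * a) - fps_X) * fps_deriv M -
      fps_const a * M) = 0"
    using kummer_ode_fps[of "2 * a" a] assms by (simp add: M_def)
  also have "fps_const (2 * a) = fps_const a + fps_const a"
    by simp
  finally have "fps_X * (E * fps_deriv (fps_deriv M)) +
      (fps_const a + fps_const a - fps_X) * (E * fps_deriv M) - fps_const a * Y = 0"
    unfolding Y_def by (simp only: algebra_simps)
  then have "fps_X * fps_deriv (fps_deriv Y) + (fps_const a + fps_const a) * fps_deriv Y =
      h * h * (fps_X * Y)"
    unfolding dM ddM using h by algebra
  then have ode: "fps_X * fps_deriv (fps_deriv Y) + fps_const (2 * a) * fps_deriv Y =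
      fps_const (1/4) * (fps_X * Y)"
    by (simp add: h2)
  have ne: "2 * a + of_nat n \<noteq> 0" for n
    using assms plus_of_nat_eq_0_imp by blast
  have Y_0: "Y $ 0 = 1"
    by (simp add: Y_def E_def M_def hypergeom_fps_def)
  have Y_1: "Y $ Suc 0 = 0"
    using arg_cong[OF ode, of "\<lambda>F. F $ 0"] ne[of 0] by simp
  have Y_Suc_Suc: "Y $ Suc (Suc n) = Y $ n / (4 * of_nat (n + 2) * (2 * a + of_nat (n + 1)))" for n
  proof -
    have "Y $ Suc (Suc n) * (4 * of_nat (n + 2) * (2 * a + of_nat (n + 1))) = Y $ n"
      using arg_cong[OF ode, of "\<lambda>F. F $ Suc n"] by (simp add: algebra_simps)
    moreover have "4 * of_nat (n + 2) * (2 * a + of_nat (n + 1)) \<noteq> 0"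
      using ne[of "n + 1"] by (simp only: mult_eq_0_iff of_nat_eq_0_iff) simp
    ultimately show ?thesis
      using nonzero_eq_divide_eq by blast
  qed
  fix n show "(fps_exp (-1/2) * hypergeom_fps [a] [2 * a]) $ n = bessel_fps (a + 1/2) $ n"
    unfolding E_def[symmetric] M_def[symmetric] Y_def[symmetric]
  proof (induction n rule: induct_nat_012)
    case (ge2 n)
    show ?case
    proof (cases "even n")
      case True
      then obtain k where n: "n = 2 * k" by (elim evenE)
      have "4 * of_nat (n + 2) * (2 * a + of_nat (n + 1)) = 16 * of_nat (Suc k) * (a + 1/2 + of_nat k)"
        by (simp add: n algebra_simps)
      then show ?thesis
        by (simp only: Y_Suc_Suc ge2.IH)
           (simp add: n bessel_fps_def hypergeom_fps_nth_Suc mult_ac del: of_nat_Suc)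
    qed (simp add: Y_Suc_Suc ge2.IH bessel_fps_def)
  qed (simp_all add: Y_0 Y_1 bessel_fps_def hypergeom_fps_def)
qed

section \<open>The expansion for denominator parameter \<open>2a + i\<close>\<close>

definition kummer_coeff :: "nat \<Rightarrow> complex \<Rightarrow> nat \<Rightarrow> complex" where
  "kummer_coeff i a m = pochhammer (- of_nat i) m * pochhammer (2 * a - 1) m /
     (pochhammer (2 * a + of_nat i) m * pochhammer (a - 1/2) m * 4 ^ m * fact m)"

lemma kummer_coeff_0 [simp]: "kummer_coeff i a 0 = 1"
  by (simp add: kummer_coeff_def)

lemma kummer_coeff_eq_0: "m > i \<Longrightarrow> kummer_coeff i a m = 0"
  by (simp add: kummer_coeff_def pochhammer_of_nat_eq_0_iff)

text \<open>
  This is the contiguous relation \<open>hypergeom_fps_1F1_contiguous\<close> at \<open>b = 2a + i\<close>, seen on the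
  coefficients of the expansion; the shift of the index matches the factor \<open>x\<close> there.
\<close>

lemma kummer_coeff_Suc:
  assumes "2 * a \<notin> \<int>"
  shows "kummer_coeff (Suc i) a (Suc n) = kummer_coeff i a (Suc n) -
    a / ((2 * a + of_nat i) * (2 * a + of_nat i + 1)) * kummer_coeff i (a + 1) n"
proof -
  define b where "b = 2 * a + of_nat i"
  \<comment> \<open>All three coefficients are a rational factor times \<open>Q\<close>.\<close>
  define Q where "Q = pochhammer (- of_nat i) n * pochhammer (2 * a) n /
    (pochhammer (b + 2) n * pochhammer (a + 1/2) n * 4 ^ n * fact n)"
  have ne: "2 * a + of_int k \<noteq> 0" for k
    using assms by (metis Ints_minus Ints_of_int eq_neg_iff_add_eq_0)
  have a: "a \<noteq> 0" "a - 1/2 \<noteq> 0" and b: "b \<noteq> 0" "b + 1 \<noteq> 0" "b + of_nat n + 1 \<noteq> 0"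
    using ne[of 0] ne[of "-1"] ne[of "int i"] ne[of "int i + 1"] ne[of "int i + int n + 1"]
    by (auto simp: b_def add_ac mult.commute)
  have shift: "- of_nat (Suc i) + 1 = (- of_nat i :: complex)"
    by simp
  have neg: "pochhammer (- of_nat i) (Suc n) = pochhammer (- of_nat i) n * (of_nat n - of_nat i :: complex)"
    "pochhammer (- of_nat (Suc i)) (Suc n) = - (of_nat i + 1) * pochhammer (- of_nat i :: complex) n"
    by (simp add: pochhammer_Suc) (simp only: pochhammer_rec shift, simp)
  have b1: "pochhammer (b + 1) (Suc n) = (b + 1) * pochhammer (b + 2) n"
    by (simp add: pochhammer_rec add.assoc)
  have "pochhammer b (Suc n) * (b + of_nat n + 1) = pochhammer b (Suc (Suc n))"
    by (subst (2) pochhammer_Suc) (simp add: algebra_simps)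
  also have "\<dots> = b * (b + 1) * pochhammer (b + 2) n"
    by (simp add: pochhammer_rec add.assoc)
  finally have b0: "pochhammer b (Suc n) = b * (b + 1) * pochhammer (b + 2) n / (b + of_nat n + 1)"
    using b by (simp add: field_simps)
  have twice: "pochhammer (2 * a - 1) (Suc n) / pochhammer (a - 1/2) (Suc n) =
      2 * (pochhammer (2 * a) n / pochhammer (a + 1/2) n)"
  proof -
    have up: "pochhammer (2 * a - 1) (Suc n) = 2 * (a - 1/2) * pochhammer (2 * a) n"
      by (simp add: pochhammer_rec right_diff_distrib)
    have down: "pochhammer (a - 1/2) (Suc n) = (a - 1/2) * pochhammer (a + 1/2) n"
      by (simp add: pochhammer_rec add.commute)
    have "2 * c * p / (c * q) = 2 * (p / q)" if "c \<noteq> 0" for c p q :: complex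
      using that by simp
    from this[OF a(2)] show ?thesis
      unfolding up down .
  qed
  have "2 * a * pochhammer (2 * a + 1) n = pochhammer (2 * a) n * (2 * a + of_nat n)"
    by (simp flip: pochhammer_rec pochhammer_Suc)
  then have up: "pochhammer (2 * a + 1) n = pochhammer (2 * a) n * (2 * a + of_nat n) / (2 * a)"
    using a by (simp add: field_simps)
  have coeff_Suc: "kummer_coeff k a (Suc n) = pochhammer (- of_nat k) (Suc n) /
      pochhammer (2 * a + of_nat k) (Suc n) *
      (pochhammer (2 * a) n / (2 * of_nat (Suc n) * pochhammer (a + 1/2) n * 4 ^ n * fact n))" for k
  proof -
    have "kummer_coeff k a (Suc n) = pochhammer (- of_nat k) (Suc n) /
      pochhammer (2 * a + of_nat k) (Suc n) *
      (pochhammer (2 * a - 1) (Suc n) / pochhammer (a - 1/2) (Suc n)) / (4 ^ Suc n * fact (Suc n))"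
      by (simp add: kummer_coeff_def)
    then show ?thesis
      by (simp add: twice)
  qed
  have 1: "kummer_coeff (Suc i) a (Suc n) = - (of_nat i + 1) / (2 * of_nat (Suc n) * (b + 1)) * Q"
  proof -
    have "2 * a + of_nat (Suc i) = b + 1"
      by (simp add: b_def)
    then show ?thesis
      unfolding coeff_Suc neg(2) Q_def by (simp only: b1) (simp add: mult_ac del: of_nat_Suc)
  qed
  have 2: "kummer_coeff i a (Suc n) = (of_nat n - of_nat i) * (b + of_nat n + 1) /
      (2 * of_nat (Suc n) * b * (b + 1)) * Q"
    using b0 by (simp add: coeff_Suc neg(1) Q_def b_def mult_ac del: of_nat_Suc)
  have "2 * (a + 1) + of_nat i = b + 2" "2 * (a + 1) - 1 = 2 * a + 1" "a + 1 - 1/2 = a + 1/2"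
    by (simp_all add: b_def)
  then have 3: "kummer_coeff i (a + 1) n = (2 * a + of_nat n) / (2 * a) * Q"
    by (simp only: kummer_coeff_def up Q_def) (simp add: mult_ac)
  have "- (of_nat i + 1) / (2 * of_nat (Suc n) * (b + 1)) =
      (of_nat n - of_nat i) * (b + of_nat n + 1) / (2 * of_nat (Suc n) * b * (b + 1)) -
      a / (b * (b + 1)) * ((2 * a + of_nat n) / (2 * a))"
  proof -
    have num: "(- (of_nat i + 1)) * b =
       (of_nat n - of_nat i) * (b + of_nat n + 1) - (2 * a + of_nat n) * of_nat (Suc n)"
      by (simp add: b_def algebra_simps)
    have "- (of_nat i + 1) / (2 * of_nat (Suc n) * (b + 1)) =
        (- (of_nat i + 1)) * b / (2 * of_nat (Suc n) * b * (b + 1))"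
      using b by simp
    moreover have "a / (b * (b + 1)) * ((2 * a + of_nat n) / (2 * a)) =
        (2 * a + of_nat n) * of_nat (Suc n) / (2 * of_nat (Suc n) * b * (b + 1))"
      using a by (simp add: mult_ac del: of_nat_Suc)
    ultimately show ?thesis
      unfolding num by (simp only: diff_divide_distrib)
  qed
  then show ?thesis
    unfolding 1 2 3 b_def[symmetric] by (simp add: left_diff_distrib)
qed

text \<open>
  Coefficientwise this is the partial fraction
  \<open>1/(b)_n - 1/(b+1)_n = n / (b)_(n+1)\<close>, whose factor \<open>n\<close> cancels against \<open>n!\<close> and so shifts the
  series by one.
\<close>

lemma hypergeom_fps_1F1_contiguous:
  assumes "b \<notin> \<int>\<^sub>\<le>\<^sub>0"
  shows "hypergeom_fps [a] [b + 1] = hypergeom_fps [a] [b] -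
    fps_const (a / (b * (b + 1))) * fps_X * hypergeom_fps [a + 1] [b + 2]"
proof (rule fps_ext)
  fix n
  have ne: "b + of_nat k \<noteq> 0" for k
    using assms plus_of_nat_eq_0_imp by blast
  show "hypergeom_fps [a] [b + 1] $ n = (hypergeom_fps [a] [b] -
    fps_const (a / (b * (b + 1))) * fps_X * hypergeom_fps [a + 1] [b + 2]) $ n"
  proof (cases n)
    case (Suc k)
    have nz: "pochhammer b n \<noteq> 0" "pochhammer (b + 1) n \<noteq> 0" for n
      using ne ne[of "Suc _"] by (auto simp: pochhammer_eq_0_iff eq_neg_iff_add_eq_0 add_ac)
    have "b * (b + 1) * pochhammer (b + 2) k = pochhammer b (Suc (Suc k))"
      by (simp add: pochhammer_rec add.assoc)
    also have "\<dots> = pochhammer b (Suc k) * (b + of_nat (Suc k))"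
      by (rule pochhammer_Suc)
    finally have b2: "pochhammer b (Suc k) * (b + of_nat (Suc k)) = b * (b + 1) * pochhammer (b + 2) k" ..
    have "b * pochhammer (b + 1) (Suc k) = pochhammer b (Suc k) * (b + of_nat (Suc k))"
      by (simp only: flip: pochhammer_rec pochhammer_Suc)
    then have inv: "1 / pochhammer (b + 1) (Suc k) = b / (pochhammer b (Suc k) * (b + of_nat (Suc k)))"
      using nz[of "Suc k"] ne[of 0] ne[of "Suc k"] by (simp add: divide_simps del: of_nat_Suc)
    have partial: "1 / P - b / (P * (b + s)) = s / (P * (b + s))" if "P \<noteq> 0" "b + s \<noteq> 0" for P s
      using that by (simp add: divide_simps)
    have "1 / pochhammer b (Suc k) - 1 / pochhammer (b + 1) (Suc k) =
        of_nat (Suc k) / (b * (b + 1) * pochhammer (b + 2) k)"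
      unfolding b2[symmetric] inv by (rule partial[OF nz(1) ne])
    then have "pochhammer a (Suc k) / fact (Suc k) * (1 / pochhammer b (Suc k) - 1 / pochhammer (b + 1) (Suc k)) =
      a * pochhammer (a + 1) k / fact k / (b * (b + 1) * pochhammer (b + 2) k)"
      by (simp add: pochhammer_rec[of a] del: of_nat_Suc)
    then show ?thesis
      unfolding Suc by (simp add: hypergeom_fps_def mult.assoc algebra_simps del: of_nat_Suc fact_Suc)
  qed (simp add: hypergeom_fps_def)
qed

text \<open>
  Both the \<open>1F1\<close> and the coefficients satisfy the recurrence that leads from \<open>(a, i)\<close> and
  \<open>(a + 1, i)\<close> to \<open>(a, i + 1)\<close>, and the Bessel series fit as well: the one of index \<open>m\<close> for \<open>a + 1\<close>
  is the one of index \<open>m + 1\<close> for \<open>a\<close>.  That \<open>2a\<close> is not an integer is inherited by \<open>a + 1\<close> and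
  keeps all intermediate denominators away from 0.
\<close>

lemma kummer_second_generalised_fps_generic:
  assumes "2 * a \<notin> \<int>"
  shows "fps_exp (-1/2) * hypergeom_fps [a] [2 * a + of_nat i] =
    (\<Sum>m\<le>i. fps_const (kummer_coeff i a m) * fps_X ^ m * bessel_fps (a + of_nat m + 1/2))"
  using assms
proof (induction i arbitrary: a)
  case 0
  then show ?case using kummer_second_fps[of a] nonpos_Ints_Int[of "2 * a"] by auto
next
  case (Suc i)
  define b where "b = 2 * a + of_nat i"
  define c where "c = a / (b * (b + 1))"
  define T where "T i a m = fps_const (kummer_coeff i a m) * fps_X ^ m * bessel_fps (a + of_nat m + 1/2)"
    for i a m
  have a1: "2 * (a + 1) \<notin> \<int>"
    using Suc.prems Ints_diff[of "2 * a + 2" 2] by (auto simp: algebra_simps)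
  have b: "b \<notin> \<int>\<^sub>\<le>\<^sub>0"
    using Suc.prems Ints_diff[of b "of_nat i"] nonpos_Ints_Int[of b] by (auto simp: b_def)
  have T_Suc: "T (Suc i) a (Suc m) = T i a (Suc m) - fps_const c * fps_X * T i (a + 1) m" for m
  proof -
    have "kummer_coeff (Suc i) a (Suc m) = kummer_coeff i a (Suc m) - c * kummer_coeff i (a + 1) m"
      using kummer_coeff_Suc[OF Suc.prems, of i m] by (simp add: b_def c_def)
    moreover have "a + 1 + of_nat m + 1/2 = a + of_nat (Suc m) + 1/2"
      by simp
    ultimately show ?thesis
      unfolding T_def by (simp only: power_Suc fps_const_sub[symmetric] fps_const_mult[symmetric]
          left_diff_distrib right_diff_distrib mult_ac)
  qed
  have "fps_exp (-1/2) * hypergeom_fps [a] [2 * a + of_nat (Suc i)] =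
      fps_exp (-1/2) * hypergeom_fps [a] [2 * a + of_nat i] -
      fps_const c * fps_X * (fps_exp (-1/2) * hypergeom_fps [a + 1] [2 * (a + 1) + of_nat i])"
  proof -
    have eqs: "2 * a + of_nat (Suc i) = b + 1" "2 * (a + 1) + of_nat i = b + 2"
      by (simp_all add: b_def)
    show ?thesis
      unfolding eqs b_def[symmetric] hypergeom_fps_1F1_contiguous[OF b] c_def[symmetric]
      by (simp only: right_diff_distrib mult_ac)
  qed
  also have "\<dots> = (\<Sum>m\<le>i. T i a m) - fps_const c * fps_X * (\<Sum>m\<le>i. T i (a + 1) m)"
    by (simp only: Suc.IH[OF Suc.prems] Suc.IH[OF a1] T_def)
  \<comment> \<open>The added term vanishes because \<open>(-i)_(i+1) = 0\<close>.\<close>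
  also have "(\<Sum>m\<le>i. T i a m) = (\<Sum>m\<le>Suc i. T i a m)"
    by (simp add: T_def kummer_coeff_eq_0)
  also have "\<dots> - fps_const c * fps_X * (\<Sum>m\<le>i. T i (a + 1) m) = (\<Sum>m\<le>Suc i. T (Suc i) a m)"
    unfolding sum.atMost_Suc_shift T_Suc by (simp add: sum_subtractf sum_distrib_left) (simp add: T_def)
  finally show ?case
    by (simp only: T_def)
qed

lemma tendsto_pochhammer:
  fixes f :: "'b \<Rightarrow> complex"
  shows "(f \<longlongrightarrow> a) F \<Longrightarrow> ((\<lambda>x. pochhammer (f x) n) \<longlongrightarrow> pochhammer a n) F"
  by (rule isCont_tendsto_compose[OF isCont_pochhammer])

lemma tendsto_kummer_coeff:
  assumes f: "(f \<longlongrightarrow> a) F" and "pochhammer (2 * a + of_nat i) m \<noteq> 0" "pochhammer (a - 1/2) m \<noteq> 0"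
  shows "((\<lambda>x. kummer_coeff i (f x) m) \<longlongrightarrow> kummer_coeff i a m) F"
  unfolding kummer_coeff_def
  by (intro tendsto_intros tendsto_pochhammer f) (use assms in simp_all)

lemma tendsto_hypergeom_fps_1F1_nth:
  assumes f: "(f \<longlongrightarrow> a) F" and "2 * a + of_nat i \<notin> \<int>\<^sub>\<le>\<^sub>0"
  shows "((\<lambda>x. hypergeom_fps [f x] [2 * f x + of_nat i] $ n) \<longlongrightarrow>
     hypergeom_fps [a] [2 * a + of_nat i] $ n) F"
proof -
  have "pochhammer (2 * a + of_nat i) n \<noteq> 0"
    using assms(2) pochhammer_eq_0_imp_nonpos_Int by blast
  then show ?thesis
    unfolding hypergeom_fps_def by (simp, intro tendsto_intros tendsto_pochhammer f) simp_all
qed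

lemma tendsto_bessel_fps_nth:
  assumes f: "(f \<longlongrightarrow> b) F" and b: "b \<notin> \<int>\<^sub>\<le>\<^sub>0"
  shows "((\<lambda>x. bessel_fps (f x) $ n) \<longlongrightarrow> bessel_fps b $ n) F"
proof -
  have "pochhammer b (n div 2) \<noteq> 0"
    using b pochhammer_eq_0_imp_nonpos_Int by blast
  then show ?thesis
    unfolding bessel_fps_def hypergeom_fps_def
    by (cases "even n"; simp) (intro tendsto_intros tendsto_pochhammer f; simp)
qed

text \<open>
  Values of \<open>a\<close> with \<open>2a\<close> an integer are approached along the vertical sequence \<open>a + \<i>/(n+1)\<close>: a non-real
  \<open>2a\<close> is certainly not an integer.  The hypotheses say that no denominator vanishes in the limit.
\<close>

lemma kummer_second_generalised_fps:
  assumes "2 * a + of_nat i \<notin> \<int>\<^sub>\<le>\<^sub>0"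
    and "\<And>m. m \<le> i \<Longrightarrow> pochhammer (a - 1/2) m \<noteq> 0"
    and "\<And>m. m \<le> i \<Longrightarrow> a + of_nat m + 1/2 \<notin> \<int>\<^sub>\<le>\<^sub>0"
  shows "fps_exp (-1/2) * hypergeom_fps [a] [2 * a + of_nat i] =
    (\<Sum>m\<le>i. fps_const (kummer_coeff i a m) * fps_X ^ m * bessel_fps (a + of_nat m + 1/2))"
proof (cases "2 * a \<in> \<int>")
  case False
  then show ?thesis by (rule kummer_second_generalised_fps_generic)
next
  case True
  define f where "f n = a + \<i> / of_nat (Suc n)" for n
  have f: "f \<longlonglongrightarrow> a"
  proof -
    have "(\<lambda>n. a + \<i> * inverse (of_nat (Suc n))) \<longlonglongrightarrow> a + \<i> * 0"
      by (intro tendsto_intros LIMSEQ_Suc[OF lim_inverse_n])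
    then show ?thesis
      by (simp add: f_def[abs_def] divide_inverse)
  qed
  have generic: "2 * f n \<notin> \<int>" for n
  proof
    assume "2 * f n \<in> \<int>"
    then have "2 * f n - 2 * a \<in> \<int>"
      using True by (rule Ints_diff)
    then have "Im (2 * f n - 2 * a) = 0"
      by (elim Ints_cases) (simp only: complex_Im_of_int)
    then show False
      by (simp add: f_def Im_divide_of_nat del: of_nat_Suc)
  qed
  show ?thesis
  proof (rule fps_ext)
    fix n
    let ?L = "\<lambda>a. (fps_exp (-1/2) * hypergeom_fps [a] [2 * a + of_nat i]) $ n"
    let ?R = "\<lambda>a. (\<Sum>m\<le>i. fps_const (kummer_coeff i a m) * fps_X ^ m * bessel_fps (a + of_nat m + 1/2)) $ n"
    have "(\<lambda>k. ?L (f k)) \<longlonglongrightarrow> ?L a"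
      unfolding fps_mult_nth
      by (intro tendsto_sum tendsto_mult tendsto_const tendsto_hypergeom_fps_1F1_nth f assms(1))
    moreover have "(\<lambda>k. ?R (f k)) \<longlonglongrightarrow> ?R a"
    proof -
      have nz: "pochhammer (2 * a + of_nat i) m \<noteq> 0" for m
        using assms(1) pochhammer_eq_0_imp_nonpos_Int by blast
      have R: "?R b = (\<Sum>m\<le>i. kummer_coeff i b m * (if n < m then 0 else bessel_fps (b + of_nat m + 1/2) $ (n - m)))" for b
        by (simp add: fps_sum_nth mult.assoc fps_X_power_mult_nth)
      have "(\<lambda>k. if n < m then 0 else bessel_fps (f k + of_nat m + 1/2) $ (n - m)) \<longlonglongrightarrow>
          (if n < m then 0 else bessel_fps (a + of_nat m + 1/2) $ (n - m))" if "m \<le> i" for m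
        using assms(3)[OF that] by (auto intro!: tendsto_bessel_fps_nth tendsto_intros f)
      then show ?thesis
        unfolding R by (intro tendsto_sum tendsto_mult tendsto_kummer_coeff f nz assms(2)) auto
    qed
    ultimately show "?L a = ?R a"
      unfolding kummer_second_generalised_fps_generic[OF generic] by (rule LIMSEQ_unique)
  qed
qed

section \<open>Evaluating the expansions\<close>

lemma eval_fps_sum_entire:
  fixes f :: "'a \<Rightarrow> complex fps"
  assumes "finite A" "\<And>m. m \<in> A \<Longrightarrow> fps_conv_radius (f m) = \<infinity>"
  shows "fps_conv_radius (\<Sum>m\<in>A. f m) = \<infinity> \<and> eval_fps (\<Sum>m\<in>A. f m) x = (\<Sum>m\<in>A. eval_fps (f m) x)"
  using assms
proof (induction A rule: finite_induct)
  case (insert m A)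
  then show ?case
    using fps_conv_radius_add[of "f m" "sum f A"] by (simp add: eval_fps_add)
qed simp

lemma kummer_second_generalised:
  assumes "2 * a + of_nat i \<notin> \<int>\<^sub>\<le>\<^sub>0"
    and "\<And>m. m \<le> i \<Longrightarrow> pochhammer (a - 1/2) m \<noteq> 0"
    and "\<And>m. m \<le> i \<Longrightarrow> a + of_nat m + 1/2 \<notin> \<int>\<^sub>\<le>\<^sub>0"
  shows "hypergeom [a] [2 * a + of_nat i] x =
    exp (x / 2) * (\<Sum>m=0..i. kummer_coeff i a m * x ^ m * hypergeom [] [a + of_nat m + 1/2] (x\<^sup>2 / 16))"
proof -
  define T where "T m = fps_const (kummer_coeff i a m) * fps_X ^ m * bessel_fps (a + of_nat m + 1/2)" for m
  have mono: "fps_conv_radius (fps_const (kummer_coeff i a m) * fps_X ^ m) = \<infinity>" for m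
    using fps_conv_radius_mult[of "fps_const (kummer_coeff i a m)" "fps_X ^ m"] by simp
  have T: "fps_conv_radius (T m) = \<infinity>" for m
    using fps_conv_radius_mult[of "fps_const (kummer_coeff i a m) * fps_X ^ m" "bessel_fps (a + of_nat m + 1/2)"]
    by (simp add: T_def mono fps_conv_radius_bessel_fps)
  have "exp (- x / 2) * hypergeom [a] [2 * a + of_nat i] x =
     eval_fps (fps_exp (-1/2) * hypergeom_fps [a] [2 * a + of_nat i]) x"
    by (subst eval_fps_mult) (simp_all add: fps_conv_radius_hypergeom_fps eval_hypergeom_fps)
  also have "\<dots> = (\<Sum>m\<le>i. eval_fps (T m) x)"
    using kummer_second_generalised_fps[OF assms] eval_fps_sum_entire[of "{..i}" T x] T
    by (simp add: T_def)
  also have "\<dots> = (\<Sum>m\<le>i. kummer_coeff i a m * x ^ m * hypergeom [] [a + of_nat m + 1/2] (x\<^sup>2 / 16))"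
    unfolding T_def
    by (subst eval_fps_mult; (subst eval_fps_mult)?)
       (simp_all add: mono fps_conv_radius_bessel_fps eval_bessel_fps)
  finally have "exp (x / 2) * exp (- x / 2) * hypergeom [a] [2 * a + of_nat i] x = exp (x / 2) *
      (\<Sum>m\<le>i. kummer_coeff i a m * x ^ m * hypergeom [] [a + of_nat m + 1/2] (x\<^sup>2 / 16))"
    by (simp only: mult.assoc)
  then show ?thesis
    by (simp add: atLeast0AtMost flip: exp_add)
qed

text \<open>
  With \<open>c = a - i\<close> one has \<open>2a - i = 2c + i\<close> and \<open>(2a - i) - a = c\<close>, so Kummer's first transformation
  reduces this to the previous lemma at \<open>-x\<close>.
\<close>

corollary kummer_second_generalised_lower:
  assumes "2 * a - of_nat i \<notin> \<int>\<^sub>\<le>\<^sub>0"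
    and "\<And>m. m \<le> i \<Longrightarrow> pochhammer (a - of_nat i - 1/2) m \<noteq> 0"
    and "\<And>m. m \<le> i \<Longrightarrow> a - of_nat i + of_nat m + 1/2 \<notin> \<int>\<^sub>\<le>\<^sub>0"
  shows "hypergeom [a] [2 * a - of_nat i] x =
    exp (x / 2) * (\<Sum>m=0..i. kummer_coeff i (a - of_nat i) m * (-x) ^ m *
      hypergeom [] [a - of_nat i + of_nat m + 1/2] (x\<^sup>2 / 16))"
proof -
  have c: "2 * (a - of_nat i) + of_nat i = 2 * a - of_nat i" "2 * a - of_nat i - a = a - of_nat i"
    by (simp_all add: algebra_simps)
  have "hypergeom [a] [2 * a - of_nat i] x = exp x * hypergeom [a - of_nat i] [2 * a - of_nat i] (-x)"
    using kummer_first_transformation[OF assms(1), of a x] by (simp only: c)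
  also have "\<dots> = (exp x * exp (- x / 2)) * (\<Sum>m=0..i. kummer_coeff i (a - of_nat i) m * (-x) ^ m *
      hypergeom [] [a - of_nat i + of_nat m + 1/2] (x\<^sup>2 / 16))"
    using kummer_second_generalised[of "a - of_nat i" i "-x"] assms by (simp add: c)
  also have "exp x * exp (- x / 2) = exp (x / 2)"
    by (simp flip: exp_add)
  finally show ?thesis .
qed

section \<open>The product formulas\<close>

lemma hypergeom_product_expansion:
  assumes f: "f = exp (x / 2) * (\<Sum>m=0..i. u m * hypergeom [] [p m] (x\<^sup>2 / 16))"
    and g: "g = exp (x / 2) * (\<Sum>n=0..j. v n * hypergeom [] [q n] (x\<^sup>2 / 16))"
    and ok: "\<And>m n. m \<le> i \<Longrightarrow> n \<le> j \<Longrightarrow> denom_params_ok [p m, q n, p m + q n - 1]"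
  shows "f * g = exp x * (\<Sum>m=0..i. \<Sum>n=0..j. u m * v n *
    hypergeom [(p m + q n) / 2, (p m + q n - 1) / 2] [p m, q n, p m + q n - 1] (x\<^sup>2 / 4))"
proof -
  have "f * g = (exp (x / 2) * exp (x / 2)) * (\<Sum>m=0..i. \<Sum>n=0..j. u m * v n *
     (hypergeom [] [p m] (x\<^sup>2 / 16) * hypergeom [] [q n] (x\<^sup>2 / 16)))"
    unfolding f g by (simp add: sum_product mult_ac)
  also have "exp (x / 2) * exp (x / 2) = exp x"
    by (simp flip: exp_add)
  also have "(\<Sum>m=0..i. \<Sum>n=0..j. u m * v n *
     (hypergeom [] [p m] (x\<^sup>2 / 16) * hypergeom [] [q n] (x\<^sup>2 / 16))) =
     (\<Sum>m=0..i. \<Sum>n=0..j. u m * v n *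
    hypergeom [(p m + q n) / 2, (p m + q n - 1) / 2] [p m, q n, p m + q n - 1] (x\<^sup>2 / 4))"
    by (intro sum.cong refl) (simp add: hypergeom_0F1_mult ok)
  finally show ?thesis .
qed

text \<open>
  The common form of the three formulas.  An expansion of lower type, with \<open>2\<alpha> - i\<close>, enters with
  base parameter \<open>\<alpha> - i\<close> and sign \<open>-1\<close>, one of upper type with \<open>\<alpha>\<close> and sign \<open>1\<close>; the signs are \<open>s\<close>
  and \<open>t\<close>.
\<close>

lemma kummer_product:
  assumes f: "f = exp (x / 2) * (\<Sum>m=0..i. kummer_coeff i a m * (s * x) ^ m *
      hypergeom [] [a + of_nat m + 1/2] (x\<^sup>2 / 16))"
    and g: "g = exp (x / 2) * (\<Sum>n=0..j. kummer_coeff j b n * (t * x) ^ n *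
      hypergeom [] [b + of_nat n + 1/2] (x\<^sup>2 / 16))"
    and ok: "\<And>m n. m \<le> i \<Longrightarrow> n \<le> j \<Longrightarrow>
      denom_params_ok [a + of_nat m + 1/2, b + of_nat n + 1/2, a + b + of_nat m + of_nat n]"
  shows "f * g = exp x * (\<Sum>m=0..i. \<Sum>n=0..j.
       (s ^ m * t ^ n * pochhammer (- of_nat i) m * pochhammer (- of_nat j) n
          * pochhammer (2 * a - 1) m * pochhammer (2 * b - 1) n * x^(m+n))
       / (pochhammer (2 * a + of_nat i) m * pochhammer (2 * b + of_nat j) n
          * pochhammer (a - 1/2) m * pochhammer (b - 1/2) n
          * 2^(2*m + 2*n) * fact m * fact n)
       * hypergeom [1/2 * (a + b + of_nat m + of_nat n + 1), 1/2 * (a + b + of_nat m + of_nat n)]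
           [a + of_nat m + 1/2, b + of_nat n + 1/2, a + b + of_nat m + of_nat n] (x^2 / 4))"
proof -
  have pq: "a + of_nat m + 1/2 + (b + of_nat n + 1/2) = a + b + of_nat m + of_nat n + 1" for m n
    by simp
  have half: "1/2 * z = z / 2" for z :: complex
    by simp
  have coeff: "kummer_coeff i a m * (s * x) ^ m * (kummer_coeff j b n * (t * x) ^ n) =
       (s ^ m * t ^ n * pochhammer (- of_nat i) m * pochhammer (- of_nat j) n
          * pochhammer (2 * a - 1) m * pochhammer (2 * b - 1) n * x^(m+n))
       / (pochhammer (2 * a + of_nat i) m * pochhammer (2 * b + of_nat j) n
          * pochhammer (a - 1/2) m * pochhammer (b - 1/2) n
          * 2^(2*m + 2*n) * fact m * fact n)" for m n
  proof -
    have "2 ^ (2 * m + 2 * n) = (4 ^ m * 4 ^ n :: complex)"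
      by (simp add: power_add power_mult)
    then show ?thesis
      by (simp only: kummer_coeff_def) (simp add: power_add power_mult_distrib mult_ac)
  qed
  have "denom_params_ok [a + of_nat m + 1/2, b + of_nat n + 1/2,
      a + of_nat m + 1/2 + (b + of_nat n + 1/2) - 1]" if "m \<le> i" "n \<le> j" for m n
    using ok[OF that] unfolding pq by simp
  from hypergeom_product_expansion[OF f g this] show ?thesis
    by (simp only: pq coeff half add_diff_cancel_right')
qed

theorem theorem1:
  fixes i j :: nat and \<alpha> \<beta> x :: complex
  shows "(denom_params_ok [2 * \<alpha> + of_nat i] \<and> denom_params_ok [2 * \<beta> + of_nat j] \<and>
     (\<forall>m\<le>i. \<forall>n\<le>j.
        pochhammer (2 * \<alpha> + of_nat i) m \<noteq> 0 \<and> pochhammer (2 * \<beta> + of_nat j) n \<noteq> 0 \<and>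
        pochhammer (\<alpha> - 1/2) m \<noteq> 0 \<and> pochhammer (\<beta> - 1/2) n \<noteq> 0 \<and>
        denom_params_ok [\<alpha> + of_nat m + 1/2, \<beta> + of_nat n + 1/2,
           \<alpha> + \<beta> + of_nat m + of_nat n])
     \<longrightarrow>
     hypergeom [\<alpha>] [2 * \<alpha> + of_nat i] x * hypergeom [\<beta>] [2 * \<beta> + of_nat j] x =
     exp x * (\<Sum>m=0..i. \<Sum>n=0..j.
       (pochhammer (- of_nat i) m * pochhammer (- of_nat j) n
          * pochhammer (2 * \<alpha> - 1) m * pochhammer (2 * \<beta> - 1) n * x^(m+n))
       / (pochhammer (2 * \<alpha> + of_nat i) m * pochhammer (2 * \<beta> + of_nat j) n
          * pochhammer (\<alpha> - 1/2) m * pochhammer (\<beta> - 1/2) n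
          * 2^(2*m + 2*n) * fact m * fact n)
       * hypergeom [1/2 * (\<alpha> + \<beta> + of_nat m + of_nat n + 1),
            1/2 * (\<alpha> + \<beta> + of_nat m + of_nat n)]
           [\<alpha> + of_nat m + 1/2, \<beta> + of_nat n + 1/2,
           \<alpha> + \<beta> + of_nat m + of_nat n] (x^2 / 4))) \<and>
    (denom_params_ok [2 * \<alpha> - of_nat i] \<and> denom_params_ok [2 * \<beta> - of_nat j] \<and>
     (\<forall>m\<le>i. \<forall>n\<le>j.
        pochhammer (2 * \<alpha> - of_nat i) m \<noteq> 0 \<and> pochhammer (2 * \<beta> - of_nat j) n \<noteq> 0 \<and>
        pochhammer (\<alpha> - of_nat i - 1/2) m \<noteq> 0 \<and> pochhammer (\<beta> - of_nat j - 1/2) n \<noteq> 0 \<and>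
        denom_params_ok [\<alpha> + of_nat m - of_nat i + 1/2, \<beta> + of_nat n - of_nat j + 1/2,
           \<alpha> + \<beta> + of_nat m + of_nat n - of_nat i - of_nat j])
     \<longrightarrow>
     hypergeom [\<alpha>] [2 * \<alpha> - of_nat i] x * hypergeom [\<beta>] [2 * \<beta> - of_nat j] x =
     exp x * (\<Sum>m=0..i. \<Sum>n=0..j.
       ((-1)^(m+n) * pochhammer (- of_nat i) m * pochhammer (- of_nat j) n
          * pochhammer (2 * \<alpha> - 2 * of_nat i - 1) m * pochhammer (2 * \<beta> - 2 * of_nat j - 1) n * x^(m+n))
       / (pochhammer (2 * \<alpha> - of_nat i) m * pochhammer (2 * \<beta> - of_nat j) n
          * pochhammer (\<alpha> - of_nat i - 1/2) m * pochhammer (\<beta> - of_nat j - 1/2) n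
          * 2^(2*m + 2*n) * fact m * fact n)
       * hypergeom [1/2 * (\<alpha> + \<beta> + of_nat m + of_nat n - of_nat i - of_nat j + 1),
            1/2 * (\<alpha> + \<beta> + of_nat m + of_nat n - of_nat i - of_nat j)]
           [\<alpha> + of_nat m - of_nat i + 1/2, \<beta> + of_nat n - of_nat j + 1/2,
           \<alpha> + \<beta> + of_nat m + of_nat n - of_nat i - of_nat j] (x^2 / 4))) \<and>
    (denom_params_ok [2 * \<alpha> + of_nat i] \<and> denom_params_ok [2 * \<beta> - of_nat j] \<and>
     (\<forall>m\<le>i. \<forall>n\<le>j.
        pochhammer (2 * \<alpha> + of_nat i) m \<noteq> 0 \<and> pochhammer (2 * \<beta> - of_nat j) n \<noteq> 0 \<and>
        pochhammer (\<alpha> - 1/2) m \<noteq> 0 \<and> pochhammer (\<beta> - of_nat j - 1/2) n \<noteq> 0 \<and>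
        denom_params_ok [\<alpha> + of_nat m + 1/2, \<beta> + of_nat n - of_nat j + 1/2,
           \<alpha> + \<beta> + of_nat m + of_nat n - of_nat j])
     \<longrightarrow>
     hypergeom [\<alpha>] [2 * \<alpha> + of_nat i] x * hypergeom [\<beta>] [2 * \<beta> - of_nat j] x =
     exp x * (\<Sum>m=0..i. \<Sum>n=0..j.
       ((-1)^n * pochhammer (- of_nat i) m * pochhammer (- of_nat j) n
          * pochhammer (2 * \<alpha> - 1) m * pochhammer (2 * \<beta> - 2 * of_nat j - 1) n * x^(m+n))
       / (pochhammer (2 * \<alpha> + of_nat i) m * pochhammer (2 * \<beta> - of_nat j) n
          * pochhammer (\<alpha> - 1/2) m * pochhammer (\<beta> - of_nat j - 1/2) n
          * 2^(2*m + 2*n) * fact m * fact n)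
       * hypergeom [1/2 * (\<alpha> + \<beta> + of_nat m + of_nat n - of_nat j + 1),
            1/2 * (\<alpha> + \<beta> + of_nat m + of_nat n - of_nat j)]
           [\<alpha> + of_nat m + 1/2, \<beta> + of_nat n - of_nat j + 1/2,
           \<alpha> + \<beta> + of_nat m + of_nat n - of_nat j] (x^2 / 4)))"
proof ((intro conjI impI; (elim conjE)?), goal_cases)
  case 1
  then have ok: "denom_params_ok [\<alpha> + of_nat m + 1/2, \<beta> + of_nat n + 1/2, \<alpha> + \<beta> + of_nat m + of_nat n]"
    if "m \<le> i" "n \<le> j" for m n
    using that by blast
  have f: "hypergeom [\<alpha>] [2 * \<alpha> + of_nat i] x = exp (x / 2) * (\<Sum>m=0..i. kummer_coeff i \<alpha> m * (1 * x) ^ m *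
      hypergeom [] [\<alpha> + of_nat m + 1/2] (x\<^sup>2 / 16))"
    unfolding mult_1_left
    by (rule kummer_second_generalised) (use 1 ok[of _ 0] in \<open>auto simp: denom_params_ok_def\<close>)
  have g: "hypergeom [\<beta>] [2 * \<beta> + of_nat j] x = exp (x / 2) * (\<Sum>n=0..j. kummer_coeff j \<beta> n * (1 * x) ^ n *
      hypergeom [] [\<beta> + of_nat n + 1/2] (x\<^sup>2 / 16))"
    unfolding mult_1_left
    by (rule kummer_second_generalised) (use 1 ok[of 0] in \<open>auto simp: denom_params_ok_def\<close>)
  show ?case
    using kummer_product[OF f g ok] by (simp only: power_one mult_1_left)
next
  case 2
  have shift: "2 * (\<alpha> - of_nat i) + of_nat i = 2 * \<alpha> - of_nat i" "2 * (\<beta> - of_nat j) + of_nat j = 2 * \<beta> - of_nat j"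
    "2 * (\<alpha> - of_nat i) - 1 = 2 * \<alpha> - 2 * of_nat i - 1" "2 * (\<beta> - of_nat j) - 1 = 2 * \<beta> - 2 * of_nat j - 1"
    "\<alpha> - of_nat i + of_nat m + 1/2 = \<alpha> + of_nat m - of_nat i + 1/2"
    "\<beta> - of_nat j + of_nat n + 1/2 = \<beta> + of_nat n - of_nat j + 1/2"
    "\<alpha> - of_nat i + (\<beta> - of_nat j) + of_nat m + of_nat n = \<alpha> + \<beta> + of_nat m + of_nat n - of_nat i - of_nat j" for m n
    by (simp_all add: algebra_simps)
  have ok: "denom_params_ok [\<alpha> - of_nat i + of_nat m + 1/2, \<beta> - of_nat j + of_nat n + 1/2,
      \<alpha> - of_nat i + (\<beta> - of_nat j) + of_nat m + of_nat n]"
    if "m \<le> i" "n \<le> j" for m n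
    using that 2 unfolding shift by blast
  have f: "hypergeom [\<alpha>] [2 * \<alpha> - of_nat i] x = exp (x / 2) * (\<Sum>m=0..i. kummer_coeff i (\<alpha> - of_nat i) m * (-1 * x) ^ m *
      hypergeom [] [\<alpha> - of_nat i + of_nat m + 1/2] (x\<^sup>2 / 16))"
    unfolding mult_minus1
    by (rule kummer_second_generalised_lower) (use 2 ok[of _ 0] in \<open>auto simp: denom_params_ok_def\<close>)
  have g: "hypergeom [\<beta>] [2 * \<beta> - of_nat j] x = exp (x / 2) * (\<Sum>n=0..j. kummer_coeff j (\<beta> - of_nat j) n * (-1 * x) ^ n *
      hypergeom [] [\<beta> - of_nat j + of_nat n + 1/2] (x\<^sup>2 / 16))"
    unfolding mult_minus1
    by (rule kummer_second_generalised_lower) (use 2 ok[of 0] in \<open>auto simp: denom_params_ok_def\<close>)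
  show ?case
    using kummer_product[OF f g ok] by (simp only: shift power_add mult.assoc)
next
  case 3
  have shift: "2 * (\<beta> - of_nat j) + of_nat j = 2 * \<beta> - of_nat j"
    "2 * (\<beta> - of_nat j) - 1 = 2 * \<beta> - 2 * of_nat j - 1"
    "\<beta> - of_nat j + of_nat n + 1/2 = \<beta> + of_nat n - of_nat j + 1/2"
    "\<alpha> + (\<beta> - of_nat j) + of_nat m + of_nat n = \<alpha> + \<beta> + of_nat m + of_nat n - of_nat j" for m n
    by (simp_all add: algebra_simps)
  have ok: "denom_params_ok [\<alpha> + of_nat m + 1/2, \<beta> - of_nat j + of_nat n + 1/2,
      \<alpha> + (\<beta> - of_nat j) + of_nat m + of_nat n]"
    if "m \<le> i" "n \<le> j" for m n
    using that 3 unfolding shift by blast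
  have f: "hypergeom [\<alpha>] [2 * \<alpha> + of_nat i] x = exp (x / 2) * (\<Sum>m=0..i. kummer_coeff i \<alpha> m * (1 * x) ^ m *
      hypergeom [] [\<alpha> + of_nat m + 1/2] (x\<^sup>2 / 16))"
    unfolding mult_1_left
    by (rule kummer_second_generalised) (use 3 ok[of _ 0] in \<open>auto simp: denom_params_ok_def\<close>)
  have g: "hypergeom [\<beta>] [2 * \<beta> - of_nat j] x = exp (x / 2) * (\<Sum>n=0..j. kummer_coeff j (\<beta> - of_nat j) n * (-1 * x) ^ n *
      hypergeom [] [\<beta> - of_nat j + of_nat n + 1/2] (x\<^sup>2 / 16))"
    unfolding mult_minus1
    by (rule kummer_second_generalised_lower) (use 3 ok[of 0] in \<open>auto simp: denom_params_ok_def\<close>)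
  show ?case
    using kummer_product[OF f g ok] by (simp only: shift power_one mult_1_left)
qed

end
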